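(* Let $m>2$ and $n\ge m$, and let $\bar\psi:\mathbb{R}^m\to\mathbb{R}^n$ be a conformal polynomial parameterization of an $m$-dimensional surface in $\mathbb{R}^n$. Then $\bar\psi$ is linear in the sense that all its components are polynomials of degree at most $1$, so that the surface is an $m$-dimensional affine plane. In other words, $\bar\psi$ is a linear conformal transformation of the $m$-dimensional Cartesian framework: there exist a real number $s>0$, an $n\times m$ real matrix $Q$ with orthonormal columns, and a vector $\bar b\in\mathbb{R}^n$ such that $\bar\psi(\bar x)=s\,Q\bar x+\bar b$ for all $\bar x\in\mathbb{R}^m$.
   Context: A conformal polynomial parameterization of an $m$-dimensional surface in $\mathbb{R}^n$ is a nonconstant map $\bar\psi=(\psi^1,\dots,\psi^n):\mathbb{R}^m\to\mathbb{R}^n$, all of whose components are real polynomials in $x_1,\dots,x_m$, such that for all $i\ne j$ in $\{1,\dots,m\}$ one has $\bar\psi_{x_i}\cdot\bar\psi_{x_i}=\bar\psi_{x_j}\cdot\bar\psi_{x_j}$ and $\bar\psi_{x_i}\cdot\bar\psi_{x_j}=0$ at every point of $\mathbb{R}^m$, where subscripts denote partial derivatives and $\cdot$ is the Euclidean inner product of $\mathbb{R}^n$. *)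

theory Defs
  imports "HOL-Analysis.Analysis"
begin

(* A real polynomial in the coordinates is identified with the function it induces; over the
   reals the two determine each other, so the total degree of the function is well defined.
   The exponent vectors of total degree at most d form a finite set (finite_exponents), so the
   sum below is never the degenerate value of a sum over an infinite set. *)

definition exponents_le :: "nat \<Rightarrow> ('m::finite \<Rightarrow> nat) set" where
  "exponents_le d = {\<alpha>. (\<Sum>i\<in>UNIV. \<alpha> i) \<le> d}"

definition total_degree_le :: "(real ^ 'm \<Rightarrow> real) \<Rightarrow> nat \<Rightarrow> bool" where
  "total_degree_le f d \<longleftrightarrow>
     (\<exists>c. \<forall>x. f x = (\<Sum>\<alpha>\<in>exponents_le d. c \<alpha> * (\<Prod>i\<in>UNIV. (x $ i) ^ \<alpha> i)))"

definition partial_derivative :: "(real ^ 'm \<Rightarrow> real ^ 'n) \<Rightarrow> 'm \<Rightarrow> real ^ 'm \<Rightarrow> real ^ 'n" where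
  "partial_derivative \<psi> i x = vector_derivative (\<lambda>t. \<psi> (x + t *\<^sub>R axis i 1)) (at 0)"

definition conformal_polynomial_parameterization :: "(real ^ 'm \<Rightarrow> real ^ 'n) \<Rightarrow> bool" where
  "conformal_polynomial_parameterization \<psi> \<longleftrightarrow>
     \<not> \<psi> constant_on UNIV \<and>
     (\<forall>k. real_polynomial_function (\<lambda>x. \<psi> x $ k)) \<and>
     (\<forall>i j. i \<noteq> j \<longrightarrow> (\<forall>x.
        partial_derivative \<psi> i x \<bullet> partial_derivative \<psi> i x =
        partial_derivative \<psi> j x \<bullet> partial_derivative \<psi> j x \<and>
        partial_derivative \<psi> i x \<bullet> partial_derivative \<psi> j x = 0))"

definition orthonormal_columns :: "real ^ 'm ^ 'n \<Rightarrow> bool" where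
  "orthonormal_columns Q \<longleftrightarrow> (\<forall>i j. column i Q \<bullet> column j Q = (if i = j then 1 else 0))"

lemma finite_exponents: "finite (exponents_le d :: ('m::finite \<Rightarrow> nat) set)"
proof (rule finite_subset)
  show "(exponents_le d :: ('m \<Rightarrow> nat) set) \<subseteq> PiE UNIV (\<lambda>_. {..d})"
  proof
    fix \<alpha> :: "'m \<Rightarrow> nat" assume \<alpha>: "\<alpha> \<in> exponents_le d"
    have "\<alpha> i \<le> (\<Sum>i\<in>UNIV. \<alpha> i)" for i
      by (rule member_le_sum) auto
    then have "\<alpha> i \<le> d" for i
      using \<alpha> unfolding exponents_le_def by (metis le_trans mem_Collect_eq)
    then show "\<alpha> \<in> PiE UNIV (\<lambda>_. {..d})" by auto
  qed
  show "finite (PiE (UNIV :: 'm set) (\<lambda>_. {..d}))"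
    by (rule finite_PiE) auto
qed

lemma total_degree_le_mult:
  fixes f g :: "real ^ 'm \<Rightarrow> real"
  assumes "total_degree_le f d" "total_degree_le g e"
  shows "total_degree_le (\<lambda>x. f x * g x) (d + e)"
proof -
  define A where "A = (exponents_le d :: ('m \<Rightarrow> nat) set)"
  define B where "B = (exponents_le e :: ('m \<Rightarrow> nat) set)"
  define C where "C = (exponents_le (d + e) :: ('m \<Rightarrow> nat) set)"
  define M where "M = (\<lambda>(\<alpha>::'m \<Rightarrow> nat) (x::real^'m). \<Prod>i\<in>UNIV. (x $ i) ^ \<alpha> i)"
  obtain a where a: "f x = (\<Sum>\<alpha>\<in>A. a \<alpha> * M \<alpha> x)" for x
    using assms(1) unfolding total_degree_le_def A_def M_def by blast
  obtain b where b: "g x = (\<Sum>\<beta>\<in>B. b \<beta> * M \<beta> x)" for x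
    using assms(2) unfolding total_degree_le_def B_def M_def by blast
  define s where "s = (\<lambda>p::('m \<Rightarrow> nat) \<times> ('m \<Rightarrow> nat). \<lambda>i. fst p i + snd p i)"
  define c where "c = (\<lambda>\<gamma>. \<Sum>p\<in>{p\<in>A \<times> B. s p = \<gamma>}. a (fst p) * b (snd p))"
  have fin: "finite A" "finite B" "finite C"
    unfolding A_def B_def C_def by (rule finite_exponents)+
  have sub: "s ` (A \<times> B) \<subseteq> C"
    unfolding A_def B_def C_def exponents_le_def s_def
    by (auto simp: sum.distrib intro: add_mono)
  have M: "M (s p) x = M (fst p) x * M (snd p) x" for p x
    unfolding M_def s_def by (simp add: power_add prod.distrib)
  have "f x * g x = (\<Sum>\<gamma>\<in>C. c \<gamma> * M \<gamma> x)" for x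
  proof -
    have "f x * g x = (\<Sum>p\<in>A \<times> B. a (fst p) * b (snd p) * M (s p) x)"
      unfolding a b sum_product sum.cartesian_product M
      by (intro sum.cong) (auto simp: algebra_simps)
    also have "\<dots> = (\<Sum>\<gamma>\<in>C. \<Sum>p\<in>{p\<in>A \<times> B. s p = \<gamma>}. a (fst p) * b (snd p) * M (s p) x)"
      using fin sub by (intro sum.group [symmetric]) auto
    also have "\<dots> = (\<Sum>\<gamma>\<in>C. c \<gamma> * M \<gamma> x)"
      unfolding c_def sum_distrib_right by (intro sum.cong) auto
    finally show ?thesis .
  qed
  then show ?thesis
    unfolding total_degree_le_def C_def M_def by blast
qed

lemma total_degree_le_mono:
  fixes f :: "real ^ 'm \<Rightarrow> real"
  assumes "total_degree_le f d" "d \<le> e"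
  shows "total_degree_le f e"
proof -
  obtain c where c: "\<And>x. f x = (\<Sum>\<alpha>\<in>exponents_le d. c \<alpha> * (\<Prod>i\<in>UNIV. (x $ i) ^ \<alpha> i))"
    using assms(1) unfolding total_degree_le_def by blast
  have sub: "(exponents_le d :: ('m \<Rightarrow> nat) set) \<subseteq> exponents_le e"
    using assms(2) by (auto simp: exponents_le_def)
  have "f x = (\<Sum>\<alpha>\<in>exponents_le e. (if \<alpha> \<in> exponents_le d then c \<alpha> else 0) *
                (\<Prod>i\<in>UNIV. (x $ i) ^ \<alpha> i))" for x
    unfolding c using sub finite_exponents
    by (intro sum.mono_neutral_cong_left) auto
  then show ?thesis
    unfolding total_degree_le_def
    by (intro exI[of _ "\<lambda>\<alpha>. if \<alpha> \<in> exponents_le d then c \<alpha> else 0"]) blast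
qed

lemma total_degree_le_add:
  fixes f g :: "real ^ 'm \<Rightarrow> real"
  assumes "total_degree_le f d" "total_degree_le g d"
  shows "total_degree_le (\<lambda>x. f x + g x) d"
proof -
  obtain a b where
    "\<And>x. f x = (\<Sum>\<alpha>\<in>exponents_le d. a \<alpha> * (\<Prod>i\<in>UNIV. (x $ i) ^ \<alpha> i))"
    "\<And>x. g x = (\<Sum>\<alpha>\<in>exponents_le d. b \<alpha> * (\<Prod>i\<in>UNIV. (x $ i) ^ \<alpha> i))"
    using assms unfolding total_degree_le_def by blast
  then show ?thesis
    unfolding total_degree_le_def
    by (intro exI[of _ "\<lambda>\<alpha>. a \<alpha> + b \<alpha>"]) (simp add: sum.distrib algebra_simps)
qed

lemma total_degree_le_const: "total_degree_le (\<lambda>x::real^'m. k) 0"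
proof -
  have "exponents_le 0 = {\<lambda>_::'m. 0::nat}"
    by (auto simp: exponents_le_def)
  then show ?thesis
    unfolding total_degree_le_def by (intro exI[of _ "\<lambda>_. k"]) simp
qed

lemma total_degree_le_coordinate: "total_degree_le (\<lambda>x::real^'m. x $ j) 1"
proof -
  define \<delta> where "\<delta> = (\<lambda>i::'m. if i = j then 1 else 0::nat)"
  have mem: "\<delta> \<in> exponents_le 1"
    by (simp add: \<delta>_def exponents_le_def)
  have "(\<Prod>i\<in>UNIV. (x $ i) ^ \<delta> i) = x $ j" for x :: "real^'m"
  proof -
    have "(\<Prod>i\<in>UNIV. (x $ i) ^ \<delta> i) = (\<Prod>i\<in>UNIV. if i = j then x $ i else 1)"
      unfolding \<delta>_def by (intro prod.cong) auto
    then show ?thesis by simp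
  qed
  then have "x $ j = (\<Sum>\<alpha>\<in>exponents_le 1. (if \<alpha> = \<delta> then 1 else 0) *
                (\<Prod>i\<in>UNIV. (x $ i) ^ \<alpha> i))" for x :: "real^'m"
    using mem by (simp add: finite_exponents if_distrib[of "\<lambda>z. z * _"] cong: if_cong)
  then show ?thesis
    unfolding total_degree_le_def by (intro exI[of _ "\<lambda>\<alpha>. if \<alpha> = \<delta> then 1 else 0"]) blast
qed

lemma total_degree_le_sum:
  fixes f :: "'i \<Rightarrow> real ^ 'm \<Rightarrow> real"
  assumes "finite I" "\<And>i. i \<in> I \<Longrightarrow> total_degree_le (f i) d"
  shows "total_degree_le (\<lambda>x. \<Sum>i\<in>I. f i x) d"
  using assms
proof (induction I rule: finite_induct)
  case empty
  show ?case
    using total_degree_le_mono[OF total_degree_le_const[of 0]] by simp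
next
  case (insert i I)
  then show ?case
    using total_degree_le_add[of "f i" d "\<lambda>x. \<Sum>i\<in>I. f i x"] by simp
qed

lemma real_polynomial_function_iff_total_degree_le:
  fixes f :: "real ^ 'm \<Rightarrow> real"
  shows "real_polynomial_function f \<longleftrightarrow> (\<exists>d. total_degree_le f d)"
proof
  assume "real_polynomial_function f"
  then show "\<exists>d. total_degree_le f d"
  proof (induction rule: real_polynomial_function.induct)
    case (linear f)
    then interpret bounded_linear f .
    have eq: "f x = (\<Sum>j\<in>UNIV. f (axis j 1) * x $ j)" for x
    proof -
      have "f x = f (\<Sum>j\<in>UNIV. (x $ j) *\<^sub>R axis j 1)"
        using basis_expansion[of x] by (simp add: scalar_mult_eq_scaleR)
      then show ?thesis
        by (simp add: sum scaleR mult.commute)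
    qed
    have "total_degree_le (\<lambda>x. \<Sum>j\<in>UNIV. f (axis j 1) * x $ j) 1"
      using total_degree_le_mult[OF total_degree_le_const total_degree_le_coordinate]
      by (intro total_degree_le_sum) auto
    then have "total_degree_le f 1"
      unfolding eq[symmetric] .
    then show ?case ..
  next
    case (const c)
    then show ?case using total_degree_le_const by blast
  next
    case (add f g)
    then obtain d e where "total_degree_le f d" "total_degree_le g e" by blast
    then have "total_degree_le f (d + e)" "total_degree_le g (d + e)"
      using total_degree_le_mono le_add1 le_add2 by blast+
    then show ?case using total_degree_le_add by blast
  next
    case (mult f g)
    then show ?case using total_degree_le_mult by blast
  qed
next
  assume "\<exists>d. total_degree_le f d"
  then obtain d c where
    f: "\<And>x. f x = (\<Sum>\<alpha>\<in>exponents_le d. c \<alpha> * (\<Prod>i\<in>UNIV. (x $ i) ^ \<alpha> i))"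
    unfolding total_degree_le_def by blast
  have "real_polynomial_function (\<lambda>x::real^'m. \<Sum>\<alpha>\<in>exponents_le d. c \<alpha> * (\<Prod>i\<in>UNIV. (x $ i) ^ \<alpha> i))"
    by (intro real_polynomial_function_sum real_polynomial_function_prod
        real_polynomial_function.intros real_polynomial_function_power
        bounded_linear_vec_nth finite_exponents) auto
  then show "real_polynomial_function f"
    unfolding f[symmetric] .
qed

end

theory Submission
  imports Defs
begin

text \<open>Let \<open>h\<close> be the homogeneous part of top degree \<open>d\<close> of the parameterization. Rescaling shows that
  \<open>h\<close> is conformal as well. On a great circle \<open>X t = cos t u + sin t v\<close> Euler's identity and
  conformality give \<open>|(h \<circ> X)'| = d |h \<circ> X|\<close>, while the components of \<open>h \<circ> X\<close> are trigonometric
  polynomials of degree at most \<open>d\<close>. By Parseval only the frequencies \<open>\<plusminus>d\<close> occur, so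
  \<open>h (X (pi / d)) = - h u\<close> for every \<open>v\<close>. If \<open>d \<ge> 2\<close>, then \<open>h\<close> is constant on the latitude sphere at
  distance \<open>pi / d\<close> from \<open>u\<close>, which has positive dimension because \<open>m > 2\<close>; conformality forces the
  derivative of \<open>h\<close> to vanish there, and hence \<open>h u = 0\<close>. So \<open>d \<le> 1\<close>.\<close>

section \<open>Homogeneous polynomials and the decomposition into homogeneous parts\<close>

text \<open>The clauses mirror those generating \<open>real_polynomial_function\<close>, with the
  degree carried along, so that scaling and the restriction to circles follow by rule induction. The
  zero function has every degree.\<close>

inductive homogeneous_polynomial :: "nat \<Rightarrow> ('a::real_normed_vector \<Rightarrow> real) \<Rightarrow> bool" where
  linear: "bounded_linear f \<Longrightarrow> homogeneous_polynomial 1 f"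
| const: "homogeneous_polynomial 0 (\<lambda>x. c)"
| add: "homogeneous_polynomial k f \<Longrightarrow> homogeneous_polynomial k g \<Longrightarrow>
    homogeneous_polynomial k (\<lambda>x. f x + g x)"
| mult: "homogeneous_polynomial k f \<Longrightarrow> homogeneous_polynomial l g \<Longrightarrow>
    homogeneous_polynomial (k + l) (\<lambda>x. f x * g x)"

lemma homogeneous_polynomial_zero: "homogeneous_polynomial k (\<lambda>x. 0)"
proof (induction k)
  case 0
  show ?case by (rule homogeneous_polynomial.const)
next
  case (Suc k)
  show ?case
    using homogeneous_polynomial.mult[OF homogeneous_polynomial.linear[OF bounded_linear_zero] Suc]
    by simp
qed

lemma homogeneous_polynomial_sum:
  assumes "\<And>i. i \<in> I \<Longrightarrow> homogeneous_polynomial k (f i)"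
  shows "homogeneous_polynomial k (\<lambda>x. \<Sum>i\<in>I. f i x)"
  using assms
  by (induction I rule: infinite_finite_induct)
    (auto intro: homogeneous_polynomial_zero homogeneous_polynomial.add)

lemma homogeneous_polynomial_imp_polynomial:
  "homogeneous_polynomial k f \<Longrightarrow> real_polynomial_function f"
  by (induction rule: homogeneous_polynomial.induct) auto

lemma homogeneous_polynomial_scaleR:
  "homogeneous_polynomial k f \<Longrightarrow> f (s *\<^sub>R x) = s ^ k * f x"
  by (induction rule: homogeneous_polynomial.induct)
    (auto simp: linear_scale bounded_linear.linear power_add algebra_simps)

lemma homogeneous_polynomial_degree_0: "homogeneous_polynomial 0 f \<Longrightarrow> f x = f 0"
  using homogeneous_polynomial_scaleR[of 0 f 0 x] by simp

text \<open>Recursion over the generation of \<open>f\<close>. Demanding that the parts vanish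
  beyond \<open>N\<close> allows two decompositions to be summed up to a common bound and makes them
  multiply by convolution.\<close>

lemma real_polynomial_function_homogeneous_parts:
  assumes "real_polynomial_function f"
  shows "\<exists>h N. (\<forall>k. homogeneous_polynomial k (h k)) \<and> (\<forall>k>N. h k = (\<lambda>x. 0)) \<and>
    (\<forall>x. f x = (\<Sum>k\<le>N. h k x))"
  using assms
proof (induction rule: real_polynomial_function.induct)
  case (linear f)
  then show ?case
    by (intro exI[of _ "\<lambda>k. if k = 1 then f else (\<lambda>x. 0)"] exI[of _ 1])
      (auto intro: homogeneous_polynomial_zero homogeneous_polynomial.linear[unfolded One_nat_def])
next
  case (const c)
  show ?case
    by (intro exI[of _ "\<lambda>k. if k = 0 then (\<lambda>x. c) else (\<lambda>x. 0)"] exI[of _ 0])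
      (auto intro: homogeneous_polynomial_zero homogeneous_polynomial.const)
next
  case (add f g)
  then obtain a N b M where
    a: "\<And>k. homogeneous_polynomial k (a k)" "\<And>k. k > N \<Longrightarrow> a k = (\<lambda>x. 0)"
      "\<And>x. f x = (\<Sum>k\<le>N. a k x)" and
    b: "\<And>k. homogeneous_polynomial k (b k)" "\<And>k. k > M \<Longrightarrow> b k = (\<lambda>x. 0)"
      "\<And>x. g x = (\<Sum>k\<le>M. b k x)"
    by metis
  have "f x = (\<Sum>k\<le>N + M. a k x)" "g x = (\<Sum>k\<le>N + M. b k x)" for x
    unfolding a b by (rule sum.mono_neutral_left; auto simp: a(2) b(2))+
  then show ?case
    by (intro exI[of _ "\<lambda>k x. a k x + b k x"] exI[of _ "N + M"])
      (auto simp: a b sum.distrib intro: homogeneous_polynomial.add)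
next
  case (mult f g)
  then obtain a N b M where
    a: "\<And>k. homogeneous_polynomial k (a k)" "\<And>k. k > N \<Longrightarrow> a k = (\<lambda>x. 0)"
      "\<And>x. f x = (\<Sum>k\<le>N. a k x)" and
    b: "\<And>k. homogeneous_polynomial k (b k)" "\<And>k. k > M \<Longrightarrow> b k = (\<lambda>x. 0)"
      "\<And>x. g x = (\<Sum>k\<le>M. b k x)"
    by metis
  define c where "c k x = (\<Sum>i\<le>k. a i x * b (k - i) x)" for k x
  have "homogeneous_polynomial k (c k)" for k
    unfolding c_def
  proof (rule homogeneous_polynomial_sum)
    fix i assume "i \<in> {..k}"
    then show "homogeneous_polynomial k (\<lambda>x. a i x * b (k - i) x)"
      using homogeneous_polynomial.mult[OF a(1)[of i] b(1)[of "k - i"]] by simp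
  qed
  moreover have "c k = (\<lambda>x. 0)" if "k > N + M" for k
  proof
    fix x
    have "a i x * b (k - i) x = 0" for i
      using that a(2)[of i] b(2)[of "k - i"] by (cases "i > N") auto
    then show "c k x = 0"
      unfolding c_def by (blast intro: sum.neutral)
  qed
  \<comment> \<open>\<open>polynomial_product\<close>, evaluated at the point 1, is the Cauchy
    product formula for finite sums.\<close>
  moreover have "f x * g x = (\<Sum>k\<le>N + M. c k x)" for x
    using polynomial_product[of N "\<lambda>i. a i x" M "\<lambda>i. b i x" 1]
    by (simp add: a b c_def)
  ultimately show ?case by blast
qed

section \<open>Trigonometric polynomials along great circles\<close>

text \<open>Multiplication by \<open>cis (k t)\<close> shifts the frequencies
  \<open>-k, -k + 2, ..., k\<close> to \<open>0, 2, ..., 2 k\<close>, which leaves an ordinary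
  polynomial in \<open>cis (2 t)\<close>. In this form products of functions correspond to products
  of the \<open>p\<close>, and the degree bounds add.\<close>

lemma homogeneous_polynomial_great_circle:
  assumes "homogeneous_polynomial k f"
  shows "\<exists>p. degree p \<le> k \<and>
    (\<forall>t. of_real (f (cos t *\<^sub>R u + sin t *\<^sub>R v)) * cis (real k * t) = poly p (cis (2 * t)))"
  using assms
proof (induction rule: homogeneous_polynomial.induct)
  case (linear f)
  interpret bounded_linear f by fact
  \<comment> \<open>With \<open>z = cis (2 t)\<close> one has
    \<open>cos t * cis t = (1 + z) / 2\<close> and \<open>sin t * cis t = i (1 - z) / 2\<close>; the
    coefficients are read off from this.\<close>
  define p where "p = [:Complex (f u / 2) (f v / 2), Complex (f u / 2) (- f v / 2):]"
  have "of_real (f (cos t *\<^sub>R u + sin t *\<^sub>R v)) * cis t = poly p (cis (2 * t))" for t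
  proof -
    have *: "cos t * cos t = (1 + cos (2 * t)) / 2" "sin t * sin t = (1 - cos (2 * t)) / 2"
      "cos t * sin t = sin (2 * t) / 2"
      using sin_cos_squared_add3[of t]
      by (simp_all add: sin_double cos_double power2_eq_square eq_diff_eq add.commute)
    have "Re (of_real (f (cos t *\<^sub>R u + sin t *\<^sub>R v)) * cis t) =
        f u * (cos t * cos t) + f v * (cos t * sin t)"
      by (simp add: add scaleR algebra_simps)
    moreover have "Im (of_real (f (cos t *\<^sub>R u + sin t *\<^sub>R v)) * cis t) =
        f u * (cos t * sin t) + f v * (sin t * sin t)"
      by (simp add: add scaleR algebra_simps)
    ultimately show ?thesis
      unfolding * by (simp add: complex_eq_iff p_def field_simps)
  qed
  then show ?case
    by (intro exI[of _ p]) (auto simp: p_def)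
next
  case (const c)
  show ?case by (rule exI[of _ "[:of_real c:]"]) auto
next
  case (add k f g)
  then obtain p q where "degree p \<le> k" "degree q \<le> k"
    "\<And>t. of_real (f (cos t *\<^sub>R u + sin t *\<^sub>R v)) * cis (real k * t) = poly p (cis (2 * t))"
    "\<And>t. of_real (g (cos t *\<^sub>R u + sin t *\<^sub>R v)) * cis (real k * t) = poly q (cis (2 * t))"
    by metis
  then show ?case
    by (intro exI[of _ "p + q"]) (auto simp: degree_add_le algebra_simps)
next
  case (mult k f l g)
  then obtain p q where pq: "degree p \<le> k" "degree q \<le> l"
    "\<And>t. poly p (cis (2 * t)) = of_real (f (cos t *\<^sub>R u + sin t *\<^sub>R v)) * cis (real k * t)"
    "\<And>t. poly q (cis (2 * t)) = of_real (g (cos t *\<^sub>R u + sin t *\<^sub>R v)) * cis (real l * t)"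
    by metis
  then have "degree (p * q) \<le> k + l"
    by (meson add_mono degree_mult_le order_trans)
  then show ?case
    by (intro exI[of _ "p * q"])
      (auto simp: pq distrib_right cis_mult[symmetric])
qed

text \<open>Orthogonality of the characters of the cyclic group of order \<open>N\<close>. Sampling
  at \<open>N\<close> points can replace the integral form of Parseval because only \<open>N\<close>
  coefficients are present.\<close>

lemma discrete_parseval:
  fixes b :: "nat \<Rightarrow> complex"
  assumes "N > 0"
  shows "(\<Sum>r<N. (cmod (\<Sum>k<N. b k * cis (2 * pi * real r * real k / real N)))\<^sup>2) =
    real N * (\<Sum>k<N. (cmod (b k))\<^sup>2)"
proof -
  have orth: "(\<Sum>r<N. cis (2 * pi * real r * (real k - real l) / real N)) =
      (if k = l then of_nat N else 0)" if "k < N" "l < N" for k l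
  proof (cases "k = l")
    case False
    \<comment> \<open>An \<open>N\<close>-th root of unity; it differs from 1 because
      \<open>0 < |k - l| < N\<close>, so its geometric sum vanishes.\<close>
    define \<omega> where "\<omega> = cis (2 * pi * (real k - real l) / real N)"
    have pow: "cis (2 * pi * real r * (real k - real l) / real N) = \<omega> ^ r" for r
      unfolding \<omega>_def Complex.DeMoivre by (rule arg_cong[where f = cis]) simp
    have "\<omega> ^ N = cis (2 * pi * of_int (int k - int l))"
      unfolding \<omega>_def Complex.DeMoivre using assms by simp
    then have 1: "\<omega> ^ N = 1"
      by (metis Ints_of_int cis_multiple_2pi)
    have "\<omega> \<noteq> 1"
    proof
      assume "\<omega> = 1"
      then have "cos (2 * pi * (real k - real l) / real N) = 1"
        by (simp add: \<omega>_def complex_eq_iff)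
      then obtain n :: int where "2 * pi * (real k - real l) / real N = of_int n * 2 * pi"
        unfolding cos_one_2pi_int by blast
      then have "(2 * pi) * (real k - real l) = (2 * pi) * (of_int n * real N)"
        using assms by (simp add: field_simps)
      then have "real k - real l = of_int n * real N"
        by (subst (asm) mult_left_cancel) auto
      then have eq: "int k - int l = n * int N"
        by (metis of_int_diff of_int_eq_iff of_int_mult of_int_of_nat_eq)
      then have "int N dvd int k - int l"
        by simp
      with that False show False
        using zdvd_imp_le[of "int N" "int k - int l"] zdvd_imp_le[of "int N" "int l - int k"]
        by (smt (verit) dvd_diff_commute of_nat_eq_iff of_nat_less_iff of_nat_0_le_iff)
    qed
    then have "(\<Sum>r<N. \<omega> ^ r) = 0"
      using 1 by (simp add: geometric_sum)
    with False show ?thesis by (simp add: pow)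
  qed auto
  have "complex_of_real (\<Sum>r<N. (cmod (\<Sum>k<N. b k * cis (2 * pi * real r * real k / real N)))\<^sup>2) =
      (\<Sum>r<N. \<Sum>k<N. \<Sum>l<N. b k * cnj (b l) * cis (2 * pi * real r * (real k - real l) / real N))"
    unfolding of_real_sum
  proof (rule sum.cong[OF refl])
    fix r
    have "cis (2 * pi * real r * real k / real N) * cnj (cis (2 * pi * real r * real l / real N)) =
        cis (2 * pi * real r * (real k - real l) / real N)" for k l
      by (simp add: cis_cnj cis_mult diff_divide_distrib right_diff_distrib)
    note * = this[symmetric]
    show "complex_of_real ((cmod (\<Sum>k<N. b k * cis (2 * pi * real r * real k / real N)))\<^sup>2) =
      (\<Sum>k<N. \<Sum>l<N. b k * cnj (b l) * cis (2 * pi * real r * (real k - real l) / real N))"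
      unfolding complex_norm_square cnj_sum sum_product * by (simp add: mult_ac)
  qed
  also have "\<dots> = (\<Sum>k<N. \<Sum>l<N. \<Sum>r<N.
      b k * cnj (b l) * cis (2 * pi * real r * (real k - real l) / real N))"
    by (subst sum.swap, rule sum.cong[OF refl], subst sum.swap, rule refl)
  also have "\<dots> = (\<Sum>k<N. \<Sum>l<N. if k = l then of_nat N * (b k * cnj (b l)) else 0)"
    unfolding sum_distrib_left[symmetric] by (intro sum.cong refl) (auto simp: orth)
  also have "\<dots> = complex_of_real (real N * (\<Sum>k<N. (cmod (b k))\<^sup>2))"
    by (simp add: complex_norm_square[symmetric] sum_distrib_left)
  finally show ?thesis
    unfolding of_real_eq_iff .
qed

text \<open>Equality in Bernstein's inequality: only the frequencies \<open>d\<close> and \<open>-d\<close> survive, and both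
  change sign under the shift by \<open>pi / d\<close>.\<close>

lemma trigonometric_curve_antiperiodic:
  fixes \<gamma> \<gamma>' :: "real \<Rightarrow> real ^ 'n"
  assumes "d > 0"
    and trig: "\<And>j. \<exists>p. degree p \<le> d \<and>
      (\<forall>t. of_real (\<gamma> t $ j) * cis (real d * t) = poly p (cis (2 * t)))"
    and der: "\<And>t. (\<gamma> has_vector_derivative \<gamma>' t) (at t)"
    and speed: "\<And>t. norm (\<gamma>' t) = real d * norm (\<gamma> t)"
  shows "\<gamma> (pi / real d) = - \<gamma> 0"
proof -
  obtain p where p: "\<And>j. degree (p j) \<le> d"
    "\<And>j t. of_real (\<gamma> t $ j) * cis (real d * t) = poly (p j) (cis (2 * t))"
    using trig by metis
  define a where "a j k = coeff (p j) k" for j k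
  \<comment> \<open>There are \<open>d + 1\<close> coefficients, and as many sample points below;
    \<open>\<nu> k\<close> runs through the frequencies \<open>-d, -d + 2, ..., d\<close>.\<close>
  define N where "N = Suc d"
  define \<nu> where "\<nu> k = 2 * real k - real d" for k
  have polyp: "poly (p j) z = (\<Sum>k<N. a j k * z ^ k)" for j z
  proof -
    have "poly (p j) z = (\<Sum>k\<le>degree (p j). a j k * z ^ k)"
      by (simp add: poly_altdef a_def)
    also have "\<dots> = (\<Sum>k<N. a j k * z ^ k)"
      by (rule sum.mono_neutral_left) (use p(1)[of j] in \<open>auto simp: N_def a_def coeff_eq_0\<close>)
    finally show ?thesis .
  qed
  have expand: "of_real (\<gamma> t $ j) = (\<Sum>k<N. a j k * cis (\<nu> k * t))" for j t
  proof -
    have "of_real (\<gamma> t $ j) = (of_real (\<gamma> t $ j) * cis (real d * t)) * cis (- (real d * t))"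
      by (simp add: cis_mult mult.assoc)
    also have "\<dots> = (\<Sum>k<N. a j k * (cis (2 * t) ^ k * cis (- (real d * t))))"
      unfolding p(2) polyp by (simp add: sum_distrib_right mult.assoc)
    also have "\<dots> = (\<Sum>k<N. a j k * cis (\<nu> k * t))"
      unfolding Complex.DeMoivre cis_mult \<nu>_def
      by (intro sum.cong refl arg_cong2[where f = "(*)"] arg_cong[where f = cis])
        (simp add: algebra_simps)
    finally show ?thesis .
  qed
  have expand': "of_real (\<gamma>' t $ j) = (\<Sum>k<N. a j k * (\<nu> k *\<^sub>R (\<i> * cis (\<nu> k * t))))" for j t
  proof (rule vector_derivative_unique_at)
    show "((\<lambda>t. complex_of_real (\<gamma> t $ j)) has_vector_derivative of_real (\<gamma>' t $ j)) (at t)"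
      using bounded_linear.has_vector_derivative[OF bounded_linear_of_real
          bounded_linear.has_vector_derivative[OF bounded_linear_vec_nth der]] .
    have "((\<lambda>t. \<Sum>k<N. a j k * cis (\<nu> k * t)) has_vector_derivative
        (\<Sum>k<N. a j k * (\<nu> k *\<^sub>R (\<i> * cis (\<nu> k * t))))) (at t)"
    proof (intro has_vector_derivative_sum has_vector_derivative_mult_right)
      fix k
      show "((\<lambda>t. cis (\<nu> k * t)) has_vector_derivative \<nu> k *\<^sub>R (\<i> * cis (\<nu> k * t))) (at t)"
        unfolding has_vector_derivative_def
        by (auto intro!: derivative_eq_intros simp: mult.commute)
    qed
    then show "((\<lambda>t. complex_of_real (\<gamma> t $ j)) has_vector_derivative
        (\<Sum>k<N. a j k * (\<nu> k *\<^sub>R (\<i> * cis (\<nu> k * t))))) (at t)"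
      unfolding expand .
  qed
  define S where "S b t = (\<Sum>k<N. b k * cis (2 * real k * t))" for b :: "nat \<Rightarrow> complex" and t
  \<comment> \<open>Pulling out the factor \<open>cis (- d t)\<close> of modulus 1 turns the
    frequencies into \<open>2 k\<close>, so that sampling at \<open>pi r / N\<close> meets
    \<open>N\<close>-th roots of unity.\<close>
  have norm_shift: "cmod (\<Sum>k<N. b k * cis (\<nu> k * t)) = cmod (S b t)" for b t
  proof -
    have "(\<Sum>k<N. b k * cis (\<nu> k * t)) = cis (- real d * t) * S b t"
      unfolding S_def sum_distrib_left
      by (rule sum.cong) (auto simp: \<nu>_def cis_mult left_diff_distrib mult.left_commute)
    then show ?thesis by (simp add: norm_mult)
  qed
  have n1: "(\<gamma> t $ j)\<^sup>2 = (cmod (S (a j) t))\<^sup>2" for t j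
    using arg_cong[OF expand[of t j], of cmod] unfolding norm_shift
    by (metis norm_of_real power2_abs)
  have n2: "(\<gamma>' t $ j)\<^sup>2 = (cmod (S (\<lambda>k. of_real (\<nu> k) * a j k) t))\<^sup>2" for t j
  proof -
    have "complex_of_real (\<gamma>' t $ j) = \<i> * (\<Sum>k<N. (of_real (\<nu> k) * a j k) * cis (\<nu> k * t))"
      unfolding expand' sum_distrib_left by (simp add: scaleR_conv_of_real mult_ac)
    then have "cmod (\<gamma>' t $ j) = cmod (S (\<lambda>k. of_real (\<nu> k) * a j k) t)"
      unfolding norm_shift[symmetric] by (simp only: norm_mult) simp
    then show ?thesis
      by (metis norm_of_real power2_abs)
  qed
  have parseval: "(\<Sum>r<N. (cmod (S b (pi * real r / real N)))\<^sup>2) = real N * (\<Sum>k<N. (cmod (b k))\<^sup>2)"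
    for b
    using discrete_parseval[of N b] unfolding S_def N_def by (simp add: mult_ac)
  have normsq: "(norm x)\<^sup>2 = (\<Sum>j\<in>UNIV. (x $ j)\<^sup>2)" for x :: "real ^ 'n"
    by (simp add: norm_vec_def L2_set_def sum_nonneg)
  \<comment> \<open>The speed condition is squared and summed over the sample points; Parseval then
    makes it an identity between coefficients.\<close>
  have "(\<Sum>r<N. (norm (\<gamma>' (pi * real r / real N)))\<^sup>2) =
      (real d)\<^sup>2 * (\<Sum>r<N. (norm (\<gamma> (pi * real r / real N)))\<^sup>2)"
    unfolding speed by (simp add: power_mult_distrib sum_distrib_left)
  then have "real N * (\<Sum>j\<in>UNIV. \<Sum>k<N. (cmod (of_real (\<nu> k) * a j k))\<^sup>2) =
      (real d)\<^sup>2 * (real N * (\<Sum>j\<in>UNIV. \<Sum>k<N. (cmod (a j k))\<^sup>2))"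
    unfolding normsq n1 n2 sum.swap[of _ UNIV] parseval sum_distrib_left[symmetric] .
  then have "(\<Sum>j\<in>UNIV. \<Sum>k<N. (cmod (of_real (\<nu> k) * a j k))\<^sup>2) =
      (real d)\<^sup>2 * (\<Sum>j\<in>UNIV. \<Sum>k<N. (cmod (a j k))\<^sup>2)"
    by (simp add: N_def del: sum.lessThan_Suc)
  then have zero: "(\<Sum>j\<in>UNIV. \<Sum>k<N. ((real d)\<^sup>2 - (\<nu> k)\<^sup>2) * (cmod (a j k))\<^sup>2) = 0"
    by (simp add: sum_subtractf sum_distrib_left left_diff_distrib norm_mult power_mult_distrib
        del: sum.lessThan_Suc)
  \<comment> \<open>For \<open>0 \<le> k \<le> d\<close> this is nonnegative and vanishes only at
    the two ends, so the vanishing sum kills all intermediate coefficients.\<close>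
  have gap: "(real d)\<^sup>2 - (\<nu> k)\<^sup>2 = 4 * real k * (real d - real k)" for k
    by (simp add: \<nu>_def power2_eq_square algebra_simps)
  have nonneg: "((real d)\<^sup>2 - (\<nu> k)\<^sup>2) * (cmod (a j k))\<^sup>2 \<ge> 0" if "k < N" for j k
    unfolding gap using that by (auto simp: N_def intro!: mult_nonneg_nonneg)
  have "\<forall>j\<in>UNIV. (\<Sum>k<N. ((real d)\<^sup>2 - (\<nu> k)\<^sup>2) * (cmod (a j k))\<^sup>2) = 0"
    using zero by (subst (asm) sum_nonneg_eq_0_iff) (auto intro!: sum_nonneg nonneg)
  then have "\<forall>k\<in>{..<N}. ((real d)\<^sup>2 - (\<nu> k)\<^sup>2) * (cmod (a j k))\<^sup>2 = 0" for j
    by (subst (asm) sum_nonneg_eq_0_iff) (auto intro!: nonneg)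
  then have extreme: "k = 0 \<or> k = d" if "k < N" "a j k \<noteq> 0" for j k
    using that unfolding gap by auto
  have "of_real (\<gamma> (pi / real d) $ j) = - complex_of_real (\<gamma> 0 $ j)" for j
    unfolding expand sum_negf[symmetric]
  proof (rule sum.cong[OF refl])
    fix k assume "k \<in> {..<N}"
    then have "a j k = 0 \<or> k = 0 \<or> k = d"
      using extreme by blast
    \<comment> \<open>The surviving frequencies are \<open>-d\<close> and \<open>d\<close>, and
      \<open>cis (- pi) = cis pi = -1\<close>.\<close>
    then show "a j k * cis (\<nu> k * (pi / real d)) = - (a j k * cis (\<nu> k * 0))"
      using \<open>d > 0\<close> by (auto simp: \<nu>_def complex_eq_iff)
  qed
  then show ?thesis
    by (simp add: vec_eq_iff flip: of_real_minus)
qed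

text \<open>Conformality in a form free of the conformal factor, so that it passes to limits.\<close>

definition conformal_map :: "('a::real_inner \<Rightarrow> 'b::real_inner) \<Rightarrow> bool" where
  "conformal_map L \<longleftrightarrow> (\<forall>u v w z. (L u \<bullet> L v) * (w \<bullet> z) = (L w \<bullet> L z) * (u \<bullet> v))"

section \<open>Derivatives of polynomial and homogeneous maps\<close>

lemma polynomial_vec_differentiable:
  fixes \<psi> :: "'a::euclidean_space \<Rightarrow> real ^ 'n"
  assumes "\<And>j. real_polynomial_function (\<lambda>x. \<psi> x $ j)"
  shows "\<psi> differentiable at x"
  using differentiable_at_real_polynomial_function[OF assms]
  by (auto simp: differentiable_componentwise_within[of \<psi>] Basis_vec_def inner_axis)

text \<open>Differentiate \<open>h (s x)\<close> in two ways. The extra factor \<open>s\<close> on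
  the left replaces an exponent \<open>k - 1\<close>, which would be truncated for
  \<open>k = 0\<close>.\<close>

lemma has_derivative_homogeneous:
  fixes h :: "'a::real_normed_vector \<Rightarrow> 'b::real_normed_vector"
  assumes hom: "\<And>s x. h (s *\<^sub>R x) = s ^ k *\<^sub>R h x"
    and der: "\<And>x. (h has_derivative D x) (at x)"
  shows "s *\<^sub>R D (s *\<^sub>R x) v = s ^ k *\<^sub>R D x v"
proof -
  have "((\<lambda>x. h (s *\<^sub>R x)) has_derivative (\<lambda>v. D (s *\<^sub>R x) (s *\<^sub>R v))) (at x)"
    by (rule has_derivative_compose[OF _ der, where f = "\<lambda>x. s *\<^sub>R x", simplified])
      (intro derivative_intros)
  moreover have "((\<lambda>x. h (s *\<^sub>R x)) has_derivative (\<lambda>v. s ^ k *\<^sub>R D x v)) (at x)"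
    unfolding hom by (intro has_derivative_scaleR_right der)
  ultimately have "D (s *\<^sub>R x) (s *\<^sub>R v) = s ^ k *\<^sub>R D x v"
    by (metis has_derivative_unique)
  moreover have "linear (D (s *\<^sub>R x))"
    using has_derivative_linear[OF der] .
  ultimately show ?thesis by (simp add: linear_scale)
qed

text \<open>Euler's identity: differentiate along the ray through \<open>x\<close> at parameter
  1.\<close>

lemma euler_homogeneous:
  fixes h :: "'a::real_normed_vector \<Rightarrow> 'b::real_normed_vector"
  assumes hom: "\<And>s x. h (s *\<^sub>R x) = s ^ k *\<^sub>R h x"
    and der: "(h has_derivative D) (at x)"
  shows "D x = real k *\<^sub>R h x"
proof -
  have "((\<lambda>s. h (s *\<^sub>R x)) has_derivative (\<lambda>t. D (t *\<^sub>R x))) (at (1::real))"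
    by (rule has_derivative_compose[where f = "\<lambda>s. s *\<^sub>R x" and g = h])
      (auto intro!: derivative_eq_intros der)
  moreover have "((\<lambda>s::real. h (s *\<^sub>R x)) has_derivative (\<lambda>t. (t * real k) *\<^sub>R h x)) (at 1)"
    unfolding hom by (auto intro!: derivative_eq_intros)
  ultimately have "(\<lambda>t::real. D (t *\<^sub>R x)) = (\<lambda>t. (t * real k) *\<^sub>R h x)"
    by (rule has_derivative_unique)
  from fun_cong[OF this, of 1] show ?thesis by simp
qed

text \<open>Here the dimension bound enters: besides the direction \<open>v\<close> of a great
  circle through \<open>u\<close>, a second direction \<open>w\<close> is needed to rotate
  \<open>v\<close> while fixing \<open>u\<close>.\<close>

lemma orthonormal_triple_exists:
  fixes u :: "'a::euclidean_space"
  assumes "DIM('a) > 2"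
  obtains v w where "norm v = 1" "norm w = 1" "u \<bullet> v = 0" "u \<bullet> w = 0" "v \<bullet> w = 0"
proof -
  have small: "dim {u, y} < DIM('a)" for y
  proof -
    have "dim {u, y} \<le> card {u, y}"
      by (rule dim_le_card) (auto simp: span_superset)
    also have "\<dots> \<le> 2"
      by (simp add: card_insert_if)
    finally show ?thesis using assms by simp
  qed
  obtain v where v: "v \<noteq> 0" "\<And>z. z \<in> span {u, u} \<Longrightarrow> orthogonal v z"
    using orthogonal_to_subspace_exists[OF small[of u]] by blast
  obtain w where w: "w \<noteq> 0" "\<And>z. z \<in> span {u, v} \<Longrightarrow> orthogonal w z"
    using orthogonal_to_subspace_exists[OF small[of v]] by blast
  have "v \<bullet> u = 0" "w \<bullet> u = 0" "w \<bullet> v = 0"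
    using v(2)[of u] w(2)[of u] w(2)[of v] by (auto simp: orthogonal_def span_base)
  with v(1) w(1) show thesis
    by (intro that[of "sgn v" "sgn w"]) (auto simp: sgn_div_norm norm_sgn inner_commute)
qed

section \<open>Conformal homogeneous maps of degree at least two\<close>

lemma homogeneous_conformal_vanishes:
  fixes h :: "'a::euclidean_space \<Rightarrow> real ^ 'n"
  assumes dim: "DIM('a) > 2" and d: "d \<ge> 2"
    and hp: "\<And>j. homogeneous_polynomial d (\<lambda>x. h x $ j)"
    and der: "\<And>x. (h has_derivative D x) (at x)"
    and conf: "\<And>x. conformal_map (D x)"
  shows "h x = 0"
proof -
  have hom: "h (s *\<^sub>R x) = s ^ d *\<^sub>R h x" for s x
    using homogeneous_polynomial_scaleR[OF hp] by (simp add: vec_eq_iff)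
  have euler: "D x x = real d *\<^sub>R h x" for x
    using euler_homogeneous[OF hom der] .
  have conf: "(D x u \<bullet> D x v) * (w \<bullet> z) = (D x w \<bullet> D x z) * (u \<bullet> v)" for x u v w z
    using conf unfolding conformal_map_def by blast
  have half_turn: "h (cos (pi / d) *\<^sub>R u + sin (pi / d) *\<^sub>R v) = - h u"
    if uv: "norm u = 1" "norm v = 1" "u \<bullet> v = 0" for u v
  proof -
    define X where "X t = cos t *\<^sub>R u + sin t *\<^sub>R v" for t
    define X' where "X' t = - sin t *\<^sub>R u + cos t *\<^sub>R v" for t
    have sq: "u \<bullet> u = 1" "v \<bullet> v = 1" "v \<bullet> u = 0"
      using uv by (auto simp: norm_eq_1 inner_commute)
    have XX: "X t \<bullet> X t = 1" "X' t \<bullet> X' t = 1" for t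
      unfolding X_def X'_def using sin_cos_squared_add3[of t]
      by (simp_all add: inner_add_left inner_add_right inner_diff_left inner_diff_right sq uv(3)
          add.commute)
    have "h (X (pi / d)) = - h (X 0)"
    proof (rule trigonometric_curve_antiperiodic)
      show "d > 0" using d by simp
      show "\<exists>p. degree p \<le> d \<and> (\<forall>t. of_real (h (X t) $ j) * cis (real d * t) = poly p (cis (2 * t)))"
        for j
        using homogeneous_polynomial_great_circle[OF hp] unfolding X_def .
      fix t
      have "(X has_vector_derivative X' t) (at t)"
        unfolding X_def[abs_def] X'_def by (auto intro!: derivative_eq_intros)
      from vector_derivative_diff_chain_within[OF this has_derivative_at_withinI[OF der]]
      show "((\<lambda>t. h (X t)) has_vector_derivative D (X t) (X' t)) (at t)"
        by (simp add: o_def)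
      \<comment> \<open>\<open>X t\<close> and \<open>X' t\<close> are unit vectors, so conformality
        equates the lengths of their images, and by Euler the image of \<open>X t\<close> is
        \<open>d\<close> times \<open>h (X t)\<close>.\<close>
      have "D (X t) (X' t) \<bullet> D (X t) (X' t) = D (X t) (X t) \<bullet> D (X t) (X t)"
        using conf[of "X t" "X' t" "X' t" "X t" "X t"] by (simp add: XX)
      then show "norm (D (X t) (X' t)) = real d * norm (h (X t))"
        unfolding euler norm_eq[symmetric] by simp
    qed
    then show ?thesis by (simp add: X_def)
  qed
  have zero: "h u = 0" if u: "norm u = 1" for u
  proof -
    obtain v w where vw: "norm v = 1" "norm w = 1" "u \<bullet> v = 0" "u \<bullet> w = 0" "v \<bullet> w = 0"
      using orthonormal_triple_exists[OF dim] by blast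
    define c where "c = cos (pi / d)"
    define s where "s = sin (pi / d)"
    \<comment> \<open>\<open>d \<ge> 2\<close> gives \<open>pi / d < pi\<close>; for
      \<open>d = 1\<close> the sine would be 0 and the latitude sphere a single point.\<close>
    have "s > 0"
      unfolding s_def using d by (intro sin_gt_zero) (auto simp: field_simps)
    define x where "x = c *\<^sub>R u + s *\<^sub>R v"
    \<comment> \<open>A circle on the latitude sphere, through \<open>x\<close> at
      \<open>t = 0\<close> with velocity \<open>s *\<^sub>R w\<close>.\<close>
    define V where "V t = c *\<^sub>R u + s *\<^sub>R (cos t *\<^sub>R v + sin t *\<^sub>R w)" for t
    have "h (V t) = - h u" for t
      unfolding V_def c_def s_def
    proof (rule half_turn[OF u])
      have "(cos t *\<^sub>R v + sin t *\<^sub>R w) \<bullet> (cos t *\<^sub>R v + sin t *\<^sub>R w) = 1"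
        using sin_cos_squared_add3[of t] vw
        by (simp add: inner_add_left inner_add_right norm_eq_1 inner_commute add.commute)
      then show "norm (cos t *\<^sub>R v + sin t *\<^sub>R w) = 1"
        by (simp add: norm_eq_1)
      show "u \<bullet> (cos t *\<^sub>R v + sin t *\<^sub>R w) = 0"
        by (simp add: inner_add_right vw)
    qed
    then have "((\<lambda>t. h (V t)) has_vector_derivative 0) (at 0)"
      by simp
    moreover have "((\<lambda>t. h (V t)) has_vector_derivative D x (s *\<^sub>R w)) (at 0)"
    proof -
      have "(V has_vector_derivative s *\<^sub>R w) (at 0)"
        unfolding V_def[abs_def] by (auto intro!: derivative_eq_intros)
      from vector_derivative_diff_chain_within[OF this has_derivative_at_withinI[OF der]]
      show ?thesis by (simp add: o_def V_def x_def)
    qed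
    ultimately have "D x (s *\<^sub>R w) = 0"
      by (metis vector_derivative_unique_at)
    \<comment> \<open>A conformal derivative that kills one nonzero vector kills every vector, in
      particular \<open>x\<close>; Euler's identity then gives \<open>h x = 0\<close>.\<close>
    then have "D x x \<bullet> D x x = 0"
      using conf[of x "s *\<^sub>R w" "s *\<^sub>R w" x x] \<open>s > 0\<close> vw by (auto simp: norm_eq_1)
    then have "h x = 0"
      using d by (simp add: euler)
    \<comment> \<open>\<open>x\<close> is \<open>u\<close> rotated by \<open>pi / d\<close> towards
      \<open>v\<close>, so \<open>h x = - h u\<close>.\<close>
    then show ?thesis
      using half_turn[OF u vw(1,3)] by (simp add: x_def c_def s_def)
  qed
  show ?thesis
  proof (cases "x = 0")
    case True
    then show ?thesis using hom[of 0 x] d by (simp add: power_0_left)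
  next
    case False
    then have "h x = norm x ^ d *\<^sub>R h (sgn x)"
      unfolding hom[symmetric] by (simp add: sgn_div_norm)
    then show ?thesis using zero[of "sgn x"] False by (simp add: norm_sgn)
  qed
qed

section \<open>The top homogeneous part and the reduction to affine maps\<close>

text \<open>The equation defining \<open>conformal_map\<close> is preserved when the map is
  multiplied by a constant, and it survives pointwise limits. Dividing by \<open>s ^ N\<close> and
  letting \<open>s\<close> tend to infinity isolates the top term.\<close>

lemma conformal_top_part:
  fixes L :: "nat \<Rightarrow> 'a::euclidean_space \<Rightarrow> 'b::euclidean_space"
  assumes "\<And>s::real. s > 0 \<Longrightarrow> conformal_map (\<lambda>v. \<Sum>k\<le>N. s ^ k *\<^sub>R L k v)"
  shows "conformal_map (L N)"
  unfolding conformal_map_def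
proof (intro allI)
  fix u v w z
  define M where "M s v = (\<Sum>k\<le>N. inverse s ^ (N - k) *\<^sub>R L k v)" for s :: real and v
  have lim: "((\<lambda>s. M s v) \<longlongrightarrow> L N v) at_top" for v
  proof -
    have "((\<lambda>s::real. inverse s ^ (N - k) *\<^sub>R L k v) \<longlongrightarrow> (if k = N then L N v else 0)) at_top"
      if "k \<le> N" for k
    proof (cases "k = N")
      case False
      have "((\<lambda>s::real. inverse s ^ (N - k) *\<^sub>R L k v) \<longlongrightarrow> 0 ^ (N - k) *\<^sub>R L k v) at_top"
        by (intro tendsto_intros tendsto_inverse_0_at_top filterlim_ident)
      with False that show ?thesis by (simp add: power_0_left)
    qed simp
    then have "((\<lambda>s. M s v) \<longlongrightarrow> (\<Sum>k\<le>N. if k = N then L N v else 0)) at_top"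
      unfolding M_def by (intro tendsto_sum) auto
    then show ?thesis by simp
  qed
  have "(M s u \<bullet> M s v) * (w \<bullet> z) = (M s w \<bullet> M s z) * (u \<bullet> v)" if "s > 0" for s
  proof -
    have "M s v = inverse s ^ N *\<^sub>R (\<Sum>k\<le>N. s ^ k *\<^sub>R L k v)" for v
      unfolding M_def scaleR_sum_right scaleR_scaleR
      by (intro sum.cong refl arg_cong2[where f = scaleR])
        (use that in \<open>simp add: power_diff_conv_inverse\<close>)
    then show ?thesis
      using assms[OF that] unfolding conformal_map_def by simp
  qed
  then have "\<forall>\<^sub>F s in at_top. (M s u \<bullet> M s v) * (w \<bullet> z) = (M s w \<bullet> M s z) * (u \<bullet> v)"
    using eventually_gt_at_top[of 0] by (rule eventually_mono[rotated]) auto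
  moreover have lims: "((\<lambda>s. (M s u \<bullet> M s v) * (w \<bullet> z)) \<longlongrightarrow> (L N u \<bullet> L N v) * (w \<bullet> z)) at_top"
    "((\<lambda>s. (M s w \<bullet> M s z) * (u \<bullet> v)) \<longlongrightarrow> (L N w \<bullet> L N z) * (u \<bullet> v)) at_top"
    by (intro tendsto_intros lim)+
  ultimately have "((\<lambda>s. (M s u \<bullet> M s v) * (w \<bullet> z)) \<longlongrightarrow> (L N w \<bullet> L N z) * (u \<bullet> v)) at_top"
    by (subst tendsto_cong)
  with lims(1) show "(L N u \<bullet> L N v) * (w \<bullet> z) = (L N w \<bullet> L N z) * (u \<bullet> v)"
    by (rule tendsto_unique[OF trivial_limit_at_top_linorder])
qed

text \<open>Let \<open>n\<close> be the least bound on the degrees of the homogeneous parts. If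
  \<open>n \<ge> 2\<close>, the part of degree \<open>n\<close> would be conformal, hence zero,
  against minimality.\<close>

lemma conformal_polynomial_affine:
  fixes \<psi> :: "'a::euclidean_space \<Rightarrow> real ^ 'n"
  assumes dim: "DIM('a) > 2"
    and poly: "\<And>j. real_polynomial_function (\<lambda>x. \<psi> x $ j)"
    and der: "\<And>x. (\<psi> has_derivative D x) (at x)"
    and conf: "\<And>x. conformal_map (D x)"
  shows "\<exists>b A. linear A \<and> (\<forall>x. \<psi> x = A x + b)"
proof -
  have "\<forall>j. \<exists>h N. (\<forall>k. homogeneous_polynomial k (h k)) \<and> (\<forall>k>N. h k = (\<lambda>x. 0)) \<and>
      (\<forall>x. \<psi> x $ j = (\<Sum>k\<le>N. h k x))"
    using real_polynomial_function_homogeneous_parts[OF poly] by blast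
  then obtain h N where h: "\<And>j k. homogeneous_polynomial k (h j k)"
    "\<And>j k. k > N j \<Longrightarrow> h j k = (\<lambda>x. 0)" "\<And>j x. \<psi> x $ j = (\<Sum>k\<le>N j. h j k x)"
    by metis
  define H where "H k x = (\<chi> j. h j k x)" for k x
  have hp: "homogeneous_polynomial k (\<lambda>x. H k x $ j)" for k j
    using h(1) by (simp add: H_def)
  have hom: "H k (s *\<^sub>R x) = s ^ k *\<^sub>R H k x" for k s x
    using homogeneous_polynomial_scaleR[OF hp] by (simp add: vec_eq_iff)
  define P where "P n \<longleftrightarrow> (\<forall>x. \<psi> x = (\<Sum>k\<le>n. H k x))" for n
  \<comment> \<open>The components come with separate bounds \<open>N j\<close>; there are finitely
    many, so their maximum serves for all.\<close>
  have "P (Max (range N))"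
    unfolding P_def
  proof
    fix x
    have "(\<Sum>k\<le>N j. h j k x) = (\<Sum>k\<le>Max (range N). h j k x)" for j
      by (rule sum.mono_neutral_left) (auto simp: h(2) intro: order_trans[OF _ Max_ge])
    then show "\<psi> x = (\<Sum>k\<le>Max (range N). H k x)"
      by (simp add: vec_eq_iff h(3) H_def)
  qed
  define n where "n = (LEAST n. P n)"
  have n: "P n"
    unfolding n_def by (rule LeastI) fact
  define E where "E k x = frechet_derivative (H k) (at x)" for k x
  have E: "(H k has_derivative E k x) (at x)" for k x
    unfolding E_def frechet_derivative_works[symmetric]
    by (intro polynomial_vec_differentiable homogeneous_polynomial_imp_polynomial[OF hp])
  have "n \<le> 1"
  proof (rule ccontr)
    assume "\<not> n \<le> 1"
    then obtain l where l: "n = Suc l" "n \<ge> 2" by (cases n) auto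
    have "conformal_map (E n x)" for x
    proof (rule conformal_top_part)
      fix s :: real assume "s > 0"
      have "(\<psi> has_derivative (\<lambda>v. \<Sum>k\<le>n. E k y v)) (at y)" for y
        using n unfolding P_def by (subst ext[of \<psi>]) (auto intro!: has_derivative_sum E)
      then have "D y = (\<lambda>v. \<Sum>k\<le>n. E k y v)" for y
        using has_derivative_unique[OF der] by blast
      \<comment> \<open>Rescaling the argument weights the part of degree \<open>k\<close> by
        \<open>s ^ k\<close>, which produces the family that \<open>conformal_top_part\<close> asks
        for.\<close>
      then have "s *\<^sub>R D (s *\<^sub>R x) v = (\<Sum>k\<le>n. s ^ k *\<^sub>R E k x v)" for v
        by (simp add: scaleR_sum_right has_derivative_homogeneous[OF hom E])
      moreover have "conformal_map (\<lambda>v. s *\<^sub>R D (s *\<^sub>R x) v)"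
        using conf[of "s *\<^sub>R x"] unfolding conformal_map_def by simp
      ultimately show "conformal_map (\<lambda>v. \<Sum>k\<le>n. s ^ k *\<^sub>R E k x v)"
        by simp
    qed
    then have "H n x = 0" for x
      using homogeneous_conformal_vanishes[OF dim \<open>n \<ge> 2\<close> hp E] by blast
    then have "P l"
      using n unfolding P_def l by simp
    then have "n \<le> l"
      unfolding n_def by (rule Least_le)
    with l show False by simp
  qed
  \<comment> \<open>Homogeneity of degree 1 alone does not give additivity; differentiability at 0
    does, since \<open>H 1\<close> then equals its derivative there.\<close>
  have lin: "linear (H 1)"
  proof -
    have "E 1 0 v = H 1 v" for v
    proof -
      have "((\<lambda>s. s *\<^sub>R v) has_vector_derivative v) (at 0)"
        by (auto intro!: derivative_eq_intros)
      from vector_derivative_diff_chain_within[OF this, of "H 1" "E 1 0"]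
      have "((\<lambda>s. H 1 (s *\<^sub>R v)) has_vector_derivative E 1 0 v) (at 0)"
        using has_derivative_at_withinI[OF E[of 1 0]] by (simp add: o_def)
      moreover have "((\<lambda>s. H 1 (s *\<^sub>R v)) has_vector_derivative H 1 v) (at 0)"
        unfolding hom by (auto intro!: derivative_eq_intros)
      ultimately show ?thesis by (metis vector_derivative_unique_at)
    qed
    then have "E 1 0 = H 1" by auto
    then show ?thesis using has_derivative_linear[OF E[of 1 0]] by simp
  qed
  have const: "H 0 x = H 0 0" for x
    using homogeneous_polynomial_degree_0[OF hp] by (metis vec_eq_iff)
  have "n = 0 \<or> n = 1" using \<open>n \<le> 1\<close> by auto
  then show ?thesis
  proof
    assume "n = 0"
    then show ?thesis
      using n const unfolding P_def by (intro exI[of _ "H 0 0"] exI[of _ "\<lambda>x. 0"])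
        (auto intro: linear_zero)
  next
    assume "n = 1"
    then have "\<psi> x = H 1 x + H 0 0" for x
      using n const[of x] unfolding P_def by simp
    with lin show ?thesis by blast
  qed
qed

section \<open>Partial derivatives and the normal form\<close>

lemma partial_derivative_eq:
  assumes "(\<psi> has_derivative D) (at x)"
  shows "partial_derivative \<psi> i x = D (axis i 1)"
proof -
  have "((\<lambda>t. x + t *\<^sub>R axis i 1) has_vector_derivative axis i 1) (at 0)"
    by (auto intro!: derivative_eq_intros)
  from vector_derivative_diff_chain_within[OF this, of \<psi> D]
  have "((\<lambda>t. \<psi> (x + t *\<^sub>R axis i 1)) has_vector_derivative D (axis i 1)) (at 0)"
    using has_derivative_at_withinI[OF assms] by (simp add: o_def)
  then show ?thesis
    unfolding partial_derivative_def by (rule vector_derivative_at)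
qed

text \<open>Expand both arguments in the coordinate axes. The first conclusion retains the factor
  \<open>c\<close>, which the second eliminates.\<close>

lemma conformal_map_if_axes:
  fixes L :: "real ^ 'm \<Rightarrow> 'b::real_inner"
  assumes "linear L"
    and "\<And>i j. L (axis i 1) \<bullet> L (axis j 1) = (if i = j then c else 0)"
  shows "L u \<bullet> L v = c * (u \<bullet> v)" and "conformal_map L"
proof -
  have "L u \<bullet> L v = c * (u \<bullet> v)" for u v
  proof -
    interpret linear L by fact
    have expand: "L x = (\<Sum>i\<in>UNIV. x $ i *\<^sub>R L (axis i 1))" for x
      using basis_expansion[of x] by (simp add: scalar_mult_eq_scaleR flip: scale sum)
    have "L u \<bullet> L v = (\<Sum>i\<in>UNIV. \<Sum>j\<in>UNIV. if i = j then c * (u $ i * v $ j) else 0)"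
      unfolding expand[of u] expand[of v] inner_sum_left inner_sum_right
      by (subst sum.swap) (intro sum.cong refl, simp add: assms(2))
    then show ?thesis
      by (simp add: inner_vec_def sum_distrib_left)
  qed
  then show "L u \<bullet> L v = c * (u \<bullet> v)" "conformal_map L"
    by (simp_all add: conformal_map_def)
qed

theorem theorem5:
  fixes \<psi> :: "real ^ 'm \<Rightarrow> real ^ 'n"
  assumes "CARD('m) > 2" and "CARD('n) \<ge> CARD('m)"
    and "conformal_polynomial_parameterization \<psi>"
  shows "(\<forall>k. total_degree_le (\<lambda>x. \<psi> x $ k) 1) \<and>
         affine (range \<psi>) \<and> aff_dim (range \<psi>) = int CARD('m) \<and>
         (\<exists>(s::real) (Q :: real ^ 'm ^ 'n) (b :: real ^ 'n).
            s > 0 \<and> orthonormal_columns Q \<and> (\<forall>x. \<psi> x = s *\<^sub>R (Q *v x) + b))"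
proof -
  have nonconst: "\<not> \<psi> constant_on UNIV"
    and poly: "\<And>k. real_polynomial_function (\<lambda>x. \<psi> x $ k)"
    and conf: "\<And>i j x. i \<noteq> j \<Longrightarrow>
        partial_derivative \<psi> i x \<bullet> partial_derivative \<psi> i x =
        partial_derivative \<psi> j x \<bullet> partial_derivative \<psi> j x"
      "\<And>i j x. i \<noteq> j \<Longrightarrow> partial_derivative \<psi> i x \<bullet> partial_derivative \<psi> j x = 0"
    using assms(3) unfolding conformal_polynomial_parameterization_def by blast+
  define D where "D x = frechet_derivative \<psi> (at x)" for x
  have der: "(\<psi> has_derivative D x) (at x)" for x
    unfolding D_def frechet_derivative_works[symmetric]
    by (rule polynomial_vec_differentiable[OF poly])
  \<comment> \<open>A reference axis: the squared length of its image serves as the common conformal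
    factor at each point.\<close>
  fix i0 :: 'm
  have axes: "D x (axis i 1) \<bullet> D x (axis j 1) =
      (if i = j then D x (axis i0 1) \<bullet> D x (axis i0 1) else 0)" for x i j
    using conf(1)[of i i0 x] conf(2)[of i j x] unfolding partial_derivative_eq[OF der] by auto
  have "conformal_map (D x)" for x
    using conformal_map_if_axes(2)[OF has_derivative_linear[OF der] axes] .
  moreover have "DIM(real ^ 'm) > 2"
    using assms(1) by simp
  ultimately obtain A b where A: "linear A" and \<psi>: "\<And>x. \<psi> x = A x + b"
    using conformal_polynomial_affine[OF _ poly der] by metis
  have "(\<psi> has_derivative A) (at x)" for x
    unfolding \<psi>[abs_def] using A
    by (auto intro!: derivative_eq_intros linear_imp_has_derivative)
  \<comment> \<open>The derivative is \<open>A\<close> at every point, so evaluation at 0 already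
    yields the conformal factor \<open>c\<close> of \<open>A\<close>.\<close>
  then have "D 0 = A"
    using has_derivative_unique[OF der] by blast
  then obtain c where axes_A: "\<And>i j. A (axis i 1) \<bullet> A (axis j 1) = (if i = j then c else 0)"
    using axes[of 0] by metis
  have AA: "A u \<bullet> A v = c * (u \<bullet> v)" for u v
    using conformal_map_if_axes(1)[OF A axes_A] .
  have "c \<noteq> 0"
  proof
    assume "c = 0"
    then have "A x = 0" for x
      using AA[of x x] by simp
    then show False
      using nonconst by (simp add: constant_on_def \<psi>)
  qed
  moreover have "c \<ge> 0"
    using axes_A[of i0 i0] by (metis inner_ge_zero)
  ultimately have "c > 0" by simp
  \<comment> \<open>\<open>A\<close> multiplies lengths by \<open>sqrt c\<close>; dividing this out
    leaves columns of length 1.\<close>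
  define s where "s = sqrt c"
  have s: "s > 0" "s * s = c"
    using \<open>c > 0\<close> by (auto simp: s_def)
  define Q where "Q = (1 / s) *\<^sub>R matrix A"
  have Q: "s *\<^sub>R (Q *v x) = A x" for x
    using s(1) by (simp add: Q_def scaleR_matrix_vector_assoc[symmetric] matrix_works A)
  have col: "column i Q = (1 / s) *\<^sub>R A (axis i 1)" for i
    using s(1) by (simp add: matrix_vector_mult_basis flip: Q)
  have orth: "orthonormal_columns Q"
    unfolding orthonormal_columns_def col using s \<open>c > 0\<close> by (auto simp: axes_A)
  have inj: "inj A"
    unfolding linear_injective_0[OF A] using AA \<open>c \<noteq> 0\<close>
    by (metis inner_eq_zero_iff inner_zero_left mult_eq_0_iff)
  have range: "range \<psi> = (+) b ` range A"
    by (auto simp: \<psi> add.commute)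
  have "affine (range \<psi>)"
    unfolding range affine_translation[symmetric]
    by (intro subspace_imp_affine linear_subspace_image[OF A] subspace_UNIV)
  moreover have "aff_dim (range \<psi>) = int CARD('m)"
    unfolding range aff_dim_translation_eq aff_dim_injective_linear_image[OF A inj] by simp
  moreover have "total_degree_le (\<lambda>x. \<psi> x $ k) 1" for k
  proof -
    have "A x $ k = (\<Sum>j\<in>UNIV. matrix A $ k $ j * x $ j)" for x
    proof -
      have "A x = matrix A *v x"
        by (simp add: matrix_works A)
      then show ?thesis
        by (simp add: matrix_vector_mult_def)
    qed
    moreover have "total_degree_le (\<lambda>x::real ^ 'm. \<Sum>j\<in>UNIV. matrix A $ k $ j * x $ j) 1"
      using total_degree_le_mult[OF total_degree_le_const total_degree_le_coordinate]
      by (intro total_degree_le_sum) auto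
    ultimately show ?thesis
      unfolding \<psi> vector_add_component
      by (intro total_degree_le_add total_degree_le_mono[OF total_degree_le_const]) simp_all
  qed
  moreover have "\<forall>x. \<psi> x = s *\<^sub>R (Q *v x) + b"
    by (simp add: Q \<psi>)
  ultimately show ?thesis
    using s(1) orth by blast
qed

end
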